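(* Let $0\le\alpha<1$ and let $h(z)=z+\sum_{n=2}^{\infty}a_nz^n$ and $g(z)=\sum_{n=1}^{\infty}b_nz^n$ be power series whose coefficients satisfy (with $a_1=1$) $$|a_n|\le\left(\frac{n+1}{2}\right)^2\quad\text{and}\quad |b_n|\le\left(\frac{n-1}{2}\right)^2\qquad\text{for all } n\ge1.$$ Then $f=h+\overline{g}$ is univalent and fully convex of order $\alpha$ in the disk $|z|<s_0$, where $s_0=s_0(\alpha)$ is the real root of the equation $$2(1-\alpha)(1-r)^5+\alpha(1+r)(1-r)^2-(1+r)(r^2+4r+1)=0$$ in the interval $(0,1)$. In particular, $f$ is univalent and fully convex in $|z|<s_0(0)\approx0.0712543$.
   Context: A complex-valued harmonic function $f$ is said to be fully convex of order $\alpha$ ($0\le\alpha<1$) in a disk $|z|<\rho$ if, for every $0<r<\rho$, $f$ maps the circle $|z|=r$ in a one-to-one manner onto a convex curve satisfying $\frac{\partial}{\partial\theta}\left(\arg\left\{\frac{\partial}{\partial\theta}f(re^{i\theta})\right\}\right)>\alpha$ for $0\le\theta\le2\pi$. Fully convex means fully convex of order $0$. *)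

theory Defs
  imports "HOL-Complex_Analysis.Complex_Analysis"
begin

text \<open>Harmonic means of class \<open>C\<^sup>2\<close> with vanishing Laplacian. The witnesses are the first and
  second partial derivatives with respect to \<open>x = Re z\<close> and \<open>y = Im z\<close>.\<close>

definition harmonic_on :: "(complex \<Rightarrow> complex) \<Rightarrow> complex set \<Rightarrow> bool" where
  "harmonic_on f S \<longleftrightarrow> open S \<and>
     (\<exists>fx fy fxx fxy fyx fyy.
        (\<forall>z\<in>S. (f has_derivative (\<lambda>w. Re w *\<^sub>R fx z + Im w *\<^sub>R fy z)) (at z)) \<and>
        (\<forall>z\<in>S. (fx has_derivative (\<lambda>w. Re w *\<^sub>R fxx z + Im w *\<^sub>R fxy z)) (at z)) \<and>
        (\<forall>z\<in>S. (fy has_derivative (\<lambda>w. Re w *\<^sub>R fyx z + Im w *\<^sub>R fyy z)) (at z)) \<and>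
        continuous_on S fxx \<and> continuous_on S fxy \<and>
        continuous_on S fyx \<and> continuous_on S fyy \<and>
        (\<forall>z\<in>S. fxx z + fyy z = 0))"

definition convex_curve :: "complex set \<Rightarrow> bool" where
  "convex_curve C \<longleftrightarrow>
     (\<exists>D. open D \<and> convex D \<and> bounded D \<and> D \<noteq> {} \<and> C = frontier D)"

text \<open>The derivative of the argument of \<open>\<gamma>'(\<theta>)\<close> is taken along a differentiable branch \<open>\<phi>\<close> of
  that argument, since the principal value jumps; it does not depend on the branch.
  The argument is defined only where \<open>\<gamma>'(\<theta>) \<noteq> 0\<close>, which is therefore required.\<close>

definition tangent_arg_deriv_gt :: "real \<Rightarrow> (real \<Rightarrow> complex) \<Rightarrow> bool" where
  "tangent_arg_deriv_gt \<alpha> \<gamma> \<longleftrightarrow>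
     (\<exists>\<gamma>' \<phi> \<phi>'.
        (\<forall>\<theta>. (\<gamma> has_vector_derivative \<gamma>' \<theta>) (at \<theta>)) \<and>
        (\<forall>\<theta>. \<gamma>' \<theta> \<noteq> 0 \<and> \<gamma>' \<theta> = complex_of_real (norm (\<gamma>' \<theta>)) * cis (\<phi> \<theta>)) \<and>
        (\<forall>\<theta>. (\<phi> has_real_derivative \<phi>' \<theta>) (at \<theta>)) \<and>
        (\<forall>\<theta>\<in>{0..2 * pi}. \<phi>' \<theta> > \<alpha>))"

definition fully_convex_order :: "real \<Rightarrow> real \<Rightarrow> (complex \<Rightarrow> complex) \<Rightarrow> bool" where
  "fully_convex_order \<alpha> \<rho> f \<longleftrightarrow>
     harmonic_on f (ball 0 \<rho>) \<and>
     (\<forall>r. 0 < r \<and> r < \<rho> \<longrightarrow>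
        inj_on f (sphere 0 r) \<and>
        convex_curve (f ` sphere 0 r) \<and>
        tangent_arg_deriv_gt \<alpha> (\<lambda>\<theta>. f (complex_of_real r * cis \<theta>)))"

definition fully_convex :: "real \<Rightarrow> (complex \<Rightarrow> complex) \<Rightarrow> bool" where
  "fully_convex \<rho> f \<longleftrightarrow> fully_convex_order 0 \<rho> f"

definition is_s0_root :: "real \<Rightarrow> real \<Rightarrow> bool" where
  "is_s0_root \<alpha> r \<longleftrightarrow> 0 < r \<and> r < 1 \<and>
     2 * (1 - \<alpha>) * (1 - r)^5 + \<alpha> * (1 + r) * (1 - r)^2 - (1 + r) * (r^2 + 4 * r + 1) = 0"

definition s0 :: "real \<Rightarrow> real" where
  "s0 \<alpha> = (THE r. is_s0_root \<alpha> r)"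

end

theory Submission
  imports Defs
begin

text \<open>Write \<open>f = z + A + cnj B\<close> with power series \<open>A\<close>, \<open>B\<close> starting at \<open>z\<^sup>2\<close> (the bound forces
\<open>b\<^sub>1 = 0\<close>). Everything follows from the single coefficient inequality
\<open>\<Sum> (n (n - \<alpha>) |a\<^sub>n| + n (n + \<alpha>) |b\<^sub>n|) r\<^sup>n < (1 - \<alpha>) r\<close>, the sum being over \<open>n \<ge> 2\<close>.

\<^item> It implies \<open>\<Sum> n (|a\<^sub>n| + |b\<^sub>n|) r\<^sup>n < r\<close>, so \<open>f\<close> differs from the identity by a map with
  Lipschitz constant below 1 on the closed disk of radius \<open>r\<close>, and \<open>f\<close> is injective.

\<^item> On the circle of radius \<open>r\<close> let \<open>D = z h' - cnj (z g')\<close> and \<open>N = z (z h')' + cnj (z (z g')')\<close>.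
  The tangent of the image curve is \<open>\<i> D\<close>, and its argument has derivative \<open>Re (N / D)\<close>. The
  triangle inequality turns the coefficient inequality into \<open>|N - D| < |N + (1 - 2 \<alpha>) D|\<close>,
  which says \<open>Re (N / D) > \<alpha>\<close>. Since \<open>D / z\<close> has positive real part, the principal logarithm
  of \<open>D / z\<close> gives a global branch of the argument and shows that the tangent turns exactly
  once (\<open>circle_tangent_angle\<close>).

\<^item> A closed curve whose tangent angle increases by \<open>2 \<pi>\<close> in one period is convex: each linear
  functional first increases and then decreases along the curve, so the curve lies strictly on
  one side of each of its tangents, and every direction is the direction of some tangent. Hence
  the curve is the frontier of its convex hull (\<open>convex_curve_turning_once\<close>).

Together these give the criterion \<open>fully_convex_order_of_coefficient_sum\<close>, and it remains to find
the radii for which the inequality holds. With the given bounds, the coefficient of \<open>r\<^sup>n\<close> in the sum is at most \<open>n\<^sup>2 (n\<^sup>2 + 1 - 2 \<alpha>) / 2\<close>. Summing this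
over \<open>n \<ge> 1\<close> gives \<open>r\<close> times the function \<open>majorant \<alpha>\<close> of \<open>r\<close>, in which the term \<open>n = 1\<close>
contributes \<open>1 - \<alpha>\<close>; so the inequality holds as soon as the majorant is below \<open>2 (1 - \<alpha>)\<close>. The
majorant is strictly increasing, and equality is the defining equation of \<open>s0\<close>.\<close>

section \<open>Power series on the unit disk\<close>

definition powser :: "(nat \<Rightarrow> 'a) \<Rightarrow> 'a \<Rightarrow> 'a::{real_normed_field,banach}"
  where "powser c z = (\<Sum>n. c n * z ^ n)"

text \<open>That is, the radius of convergence is at least 1.\<close>

definition unit_summable :: "(nat \<Rightarrow> 'a::{real_normed_field,banach}) \<Rightarrow> bool"
  where "unit_summable c \<longleftrightarrow> (\<forall>z. norm z < 1 \<longrightarrow> summable (\<lambda>n. c n * z ^ n))"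

text \<open>The coefficients of \<open>z F'(z)\<close> when \<open>c\<close> are those of \<open>F\<close>. This operator, unlike the derivative,
keeps the index of every term, and \<open>\<i>\<close> times it is differentiation with respect to the angle in
polar coordinates.\<close>

definition euler :: "(nat \<Rightarrow> 'a) \<Rightarrow> nat \<Rightarrow> 'a::real_normed_field"
  where "euler c n = of_nat n * c n"

lemma unit_summable_euler_sums:
  assumes "unit_summable c" "norm z < 1"
  shows "(\<lambda>n. euler c n * z ^ n) sums (z * (\<Sum>n. diffs c n * z ^ n))"
proof -
  have "summable (\<lambda>n. diffs c n * z ^ n)"
    using termdiff_converges[of z 1 c] assms by (auto simp: unit_summable_def)
  then have "(\<lambda>n. of_nat n * c n * z ^ (n - Suc 0)) sums (\<Sum>n. diffs c n * z ^ n)"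
    by (rule diffs_equiv)
  then have "(\<lambda>n. z * (of_nat n * c n * z ^ (n - Suc 0))) sums (z * (\<Sum>n. diffs c n * z ^ n))"
    by (rule sums_mult)
  moreover have "z * (of_nat n * c n * z ^ (n - Suc 0)) = euler c n * z ^ n" for n
    by (cases n) (auto simp: euler_def)
  ultimately show ?thesis by simp
qed

lemma unit_summable_euler: "unit_summable c \<Longrightarrow> unit_summable (euler c)"
  using unit_summable_euler_sums sums_summable unfolding unit_summable_def by blast

text \<open>The derivative is given through its product with \<open>z\<close>, which avoids an index shift and determines
it away from the origin.\<close>

lemma powser_has_field_derivative:
  assumes "unit_summable c" "norm z < 1"
  obtains d where "(powser c has_field_derivative d) (at z)" "z * d = powser (euler c) z"
proof
  show "(powser c has_field_derivative (\<Sum>n. diffs c n * z ^ n)) (at z)"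
    unfolding powser_def[abs_def]
    by (rule termdiffs_strong'[of 1]) (use assms in \<open>auto simp: unit_summable_def\<close>)
  show "z * (\<Sum>n. diffs c n * z ^ n) = powser (euler c) z"
    using unit_summable_euler_sums[OF assms] by (simp add: powser_def sums_iff)
qed

lemma powser_holomorphic:
  assumes "unit_summable c"
  shows "powser c holomorphic_on ball 0 1"
  using powser_has_field_derivative[OF assms]
  by (metis holomorphic_on_open open_ball mem_ball_0)

lemma powser_polar_deriv:
  assumes "unit_summable c" "0 \<le> r" "r < 1"
  shows "((\<lambda>t. powser c (of_real r * cis t)) has_vector_derivative
      \<i> * powser (euler c) (of_real r * cis t)) (at t)"
proof -
  let ?z = "of_real r * cis t"
  obtain d where d: "(powser c has_field_derivative d) (at ?z)"
      "?z * d = powser (euler c) ?z"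
    using powser_has_field_derivative[OF assms(1), of ?z] assms by (auto simp: norm_mult)
  have "((\<lambda>t. of_real r * cis t) has_vector_derivative \<i> * ?z) (at t)"
    by (auto intro!: derivative_eq_intros simp: has_vector_derivative_def scaleR_conv_of_real)
  from field_vector_diff_chain_at[OF this d(1)] show ?thesis
    using d(2) by (simp add: o_def mult.assoc)
qed

lemma norm_powser_le:
  assumes "unit_summable (\<lambda>n. norm (c n))" "norm z \<le> r" "r < 1"
  shows "norm (powser c z) \<le> powser (\<lambda>n. norm (c n)) r"
  unfolding powser_def
proof -
  have "0 \<le> r" using assms(2) norm_ge_zero order_trans by blast
  then have sr: "summable (\<lambda>n. norm (c n) * r ^ n)"
    using assms by (auto simp: unit_summable_def)
  have le: "norm (c n * z ^ n) \<le> norm (c n) * r ^ n" for n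
    using assms(2) by (simp add: norm_mult norm_power mult_left_mono power_mono)
  have sz: "summable (\<lambda>n. norm (c n * z ^ n))"
    by (rule summable_comparison_test'[OF sr, of 0]) (use le in simp)
  have "norm (\<Sum>n. c n * z ^ n) \<le> (\<Sum>n. norm (c n * z ^ n))"
    by (rule summable_norm[OF sz])
  also have "\<dots> \<le> (\<Sum>n. norm (c n) * r ^ n)"
    by (rule suminf_le[OF le sz sr])
  finally show "norm (\<Sum>n. c n * z ^ n) \<le> (\<Sum>n. norm (c n) * r ^ n)" .
qed

lemma unit_summable_norm:
  fixes c :: "nat \<Rightarrow> 'a::{real_normed_field,banach}"
  assumes "unit_summable c"
  shows "unit_summable (\<lambda>n. norm (c n))"
  unfolding unit_summable_def
proof (intro allI impI)
  fix r :: real assume r: "norm r < 1"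
  define x where "x = (\<bar>r\<bar> + 1) / 2"
  have x: "\<bar>r\<bar> < x" "x < 1" using r by (simp_all add: x_def)
  have "summable (\<lambda>n. norm (c n * of_real \<bar>r\<bar> ^ n))"
    by (rule powser_insidea[of c "of_real x"])
       (use assms x in \<open>auto simp: unit_summable_def\<close>)
  then have "summable (\<lambda>n. norm (norm (c n) * r ^ n))"
    by (simp add: norm_mult norm_power abs_mult power_abs)
  then show "summable (\<lambda>n. norm (c n) * r ^ n)" by (rule summable_norm_cancel)
qed

lemma unit_summable_comparison:
  fixes c :: "nat \<Rightarrow> 'a::{real_normed_field,banach}"
  assumes "unit_summable d" "\<And>n. norm (c n) \<le> d n"
  shows "unit_summable c"
  unfolding unit_summable_def
proof (intro allI impI)
  fix z :: 'a assume "norm z < 1"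
  then have "summable (\<lambda>n. d n * norm z ^ n)"
    using assms(1) by (simp add: unit_summable_def)
  then show "summable (\<lambda>n. c n * z ^ n)"
    by (rule summable_comparison_test'[where N = 0])
       (simp add: norm_mult norm_power mult_right_mono assms(2))
qed

lemma powser_euler_combination:
  fixes c :: "nat \<Rightarrow> 'a::{real_normed_field,banach}" and \<beta> :: 'a
  assumes "unit_summable c" "norm z < 1"
  defines "w \<equiv> (\<lambda>n. of_nat n * (of_nat n + \<beta>) * c n)"
  shows "unit_summable w"
    "powser w z = powser (euler (euler c)) z + \<beta> * powser (euler c) z"
proof -
  have us: "unit_summable (euler c)" "unit_summable (euler (euler c))"
    using assms unit_summable_euler by blast+
  have eq: "w n * z ^ n = euler (euler c) n * z ^ n + \<beta> * (euler c n * z ^ n)" for n z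
    by (simp add: w_def euler_def algebra_simps)
  show "unit_summable w"
    using us unfolding unit_summable_def eq by (auto intro!: summable_add summable_mult)
  show "powser w z = powser (euler (euler c)) z + \<beta> * powser (euler c) z"
    using us assms(2) unfolding powser_def eq unit_summable_def
    by (simp add: suminf_add[symmetric] suminf_mult[symmetric] summable_mult)
qed

text \<open>The bound \<open>- 1\<close> on \<open>\<beta>\<close> is what makes all the weights \<open>n (n + \<beta>)\<close> nonnegative, so that they
survive the triangle inequality unchanged.\<close>

lemma norm_powser_euler_combination_le:
  fixes c :: "nat \<Rightarrow> complex" and \<beta> :: real
  assumes "unit_summable c" "norm z \<le> r" "r < 1" "\<beta> \<ge> - 1"
  shows "norm (powser (euler (euler c)) z + of_real \<beta> * powser (euler c) z)
    \<le> powser (euler (euler (\<lambda>n. norm (c n)))) r + \<beta> * powser (euler (\<lambda>n. norm (c n))) r"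
proof -
  let ?w = "\<lambda>n. of_nat n * (of_nat n + of_real \<beta>) * c n"
  have w: "(\<lambda>n. norm (?w n)) = (\<lambda>n. real n * (real n + \<beta>) * norm (c n))"
  proof
    fix n
    have "?w n = of_real (real n * (real n + \<beta>)) * c n" by simp
    moreover have "real n * (real n + \<beta>) \<ge> 0"
      using assms(4) by (cases n) auto
    ultimately show "norm (?w n) = real n * (real n + \<beta>) * norm (c n)"
      by (simp only: norm_mult norm_of_real abs_of_nonneg)
  qed
  have r: "0 \<le> r" using assms(2) norm_ge_zero order_trans by blast
  have z: "norm z < 1" using assms by simp
  note comb = powser_euler_combination[OF assms(1) z, of "of_real \<beta>"]
  have "norm (powser ?w z) \<le> powser (\<lambda>n. norm (?w n)) r"
    by (rule norm_powser_le[OF unit_summable_norm[OF comb(1)] assms(2,3)])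
  also have "\<dots> = powser (euler (euler (\<lambda>n. norm (c n)))) r + \<beta> * powser (euler (\<lambda>n. norm (c n))) r"
    unfolding w
    by (rule powser_euler_combination(2)[OF unit_summable_norm[OF assms(1)]]) (use assms r in simp)
  finally show ?thesis unfolding comb(2) .
qed

lemma norm_powser_euler_le:
  fixes c :: "nat \<Rightarrow> complex"
  assumes "unit_summable c" "norm z \<le> r" "r < 1"
  shows "norm (powser (euler c) z) \<le> powser (euler (\<lambda>n. norm (c n))) r"
proof -
  have "(\<lambda>n. norm (euler c n)) = euler (\<lambda>n. norm (c n))"
    by (auto simp: euler_def norm_mult)
  then show ?thesis
    using norm_powser_le[of "euler c" z r] assms unit_summable_norm unit_summable_euler by metis
qed

lemma norm_power_diff_le:
  fixes z w :: complex
  assumes "norm z \<le> r" "norm w \<le> r"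
  shows "r * norm (z ^ n - w ^ n) \<le> of_nat n * r ^ n * norm (z - w)"
proof (induction n)
  case 0
  then show ?case by simp
next
  case (Suc n)
  have r: "0 \<le> r" using assms norm_ge_zero order_trans by blast
  have "z ^ Suc n - w ^ Suc n = z * (z ^ n - w ^ n) + w ^ n * (z - w)"
    by (simp add: algebra_simps)
  then have "norm (z ^ Suc n - w ^ Suc n) \<le> norm z * norm (z ^ n - w ^ n) + norm w ^ n * norm (z - w)"
    by (metis norm_mult norm_power norm_triangle_ineq)
  also have "\<dots> \<le> r * norm (z ^ n - w ^ n) + r ^ n * norm (z - w)"
    using assms by (intro add_mono mult_right_mono power_mono) auto
  also have "\<dots> \<le> of_nat n * r ^ n * norm (z - w) + r ^ n * norm (z - w)"
    using Suc by simp
  finally have "r * norm (z ^ Suc n - w ^ Suc n)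
      \<le> r * (of_nat n * r ^ n * norm (z - w) + r ^ n * norm (z - w))"
    using r by (rule mult_left_mono)
  then show ?case by (simp add: algebra_simps)
qed

text \<open>A Lipschitz estimate for a power series on a closed disk. Both sides carry a factor \<open>r\<close> so that the
bound is expressed by the Euler operator.\<close>

lemma norm_powser_diff_le:
  fixes c :: "nat \<Rightarrow> complex"
  assumes c: "unit_summable c" and zw: "norm z \<le> r" "norm w \<le> r" and "r < 1"
  shows "r * norm (powser c z - powser c w) \<le> powser (euler (\<lambda>n. norm (c n))) r * norm (z - w)"
proof -
  have r: "0 \<le> r" using zw norm_ge_zero order_trans by blast
  have "summable (\<lambda>n. euler (\<lambda>n. norm (c n)) n * r ^ n)"
    using unit_summable_euler[OF unit_summable_norm[OF c]] r \<open>r < 1\<close>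
    by (simp add: unit_summable_def)
  then have sr: "(\<lambda>n. euler (\<lambda>n. norm (c n)) n * r ^ n * norm (z - w))
      sums (powser (euler (\<lambda>n. norm (c n))) r * norm (z - w))"
    unfolding powser_def by (intro sums_mult2 summable_sums)
  have le: "norm (of_real r * (c n * (z ^ n - w ^ n)))
      \<le> euler (\<lambda>n. norm (c n)) n * r ^ n * norm (z - w)" for n
  proof -
    have "norm (of_real r * (c n * (z ^ n - w ^ n))) = norm (c n) * (r * norm (z ^ n - w ^ n))"
      using r by (simp add: norm_mult)
    also have "\<dots> \<le> norm (c n) * (of_nat n * r ^ n * norm (z - w))"
      by (intro mult_left_mono norm_power_diff_le[OF zw]) simp
    finally show ?thesis by (simp add: euler_def mult_ac)
  qed
  have sn: "summable (\<lambda>n. norm (of_real r * (c n * (z ^ n - w ^ n))))"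
    by (rule summable_comparison_test'[OF sums_summable[OF sr], of 0]) (use le in simp)
  have "norm (\<Sum>n. of_real r * (c n * (z ^ n - w ^ n)))
      \<le> (\<Sum>n. norm (of_real r * (c n * (z ^ n - w ^ n))))"
    by (rule summable_norm[OF sn])
  also have "\<dots> \<le> powser (euler (\<lambda>n. norm (c n))) r * norm (z - w)"
    using suminf_le[OF le sn sums_summable[OF sr]] sums_unique[OF sr] by simp
  finally have "norm (\<Sum>n. of_real r * (c n * (z ^ n - w ^ n)))
      \<le> powser (euler (\<lambda>n. norm (c n))) r * norm (z - w)" .
  moreover have "summable (\<lambda>n. c n * z ^ n)" "summable (\<lambda>n. c n * w ^ n)"
    using c zw \<open>r < 1\<close> by (auto simp: unit_summable_def)
  then have "(\<Sum>n. of_real r * (c n * (z ^ n - w ^ n))) = of_real r * (powser c z - powser c w)"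
    unfolding powser_def
    by (simp add: right_diff_distrib suminf_diff[symmetric] suminf_mult[symmetric] summable_diff summable_mult)
  ultimately show ?thesis
    using r by (simp add: norm_mult)
qed

section \<open>Closed curves whose tangent turns once\<close>

lemma quasiperiodic_shift:
  fixes f :: "real \<Rightarrow> 'a::real_vector"
  assumes "\<And>t. f (t + T) = f t + c"
  shows "f (t + of_int k * T) = f t + of_int k *\<^sub>R c"
proof (induction k rule: int_induct[where k=0])
  case base
  show ?case by simp
next
  case (step1 i)
  have "t + of_int (i + 1) * T = t + of_int i * T + T"
    by (simp add: algebra_simps)
  then show ?case
    using step1 assms[of "t + of_int i * T"] by (simp add: scaleR_left_distrib add.assoc)
next
  case (step2 i)
  have "t + of_int (i - 1) * T + T = t + of_int i * T"
    by (simp add: algebra_simps)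
  then have "f (t + of_int (i - 1) * T) + c = f t + of_int i *\<^sub>R c"
    using step2 assms[of "t + of_int (i - 1) * T"] by metis
  also have "\<dots> = (f t + of_int (i - 1) *\<^sub>R c) + c"
    by (simp add: scaleR_left_diff_distrib)
  finally show ?case by (rule add_right_imp_eq)
qed

lemma range_periodic:
  fixes f :: "real \<Rightarrow> 'a::real_vector"
  assumes "T > 0" and per: "\<And>t. f (t + T) = f t"
  shows "range f = f ` {t..<t + T}"
proof -
  have "f s \<in> f ` {t..<t + T}" for s
  proof
    let ?k = "\<lfloor>(s - t) / T\<rfloor>"
    show "f s = f (s + of_int (- ?k) * T)"
      using quasiperiodic_shift[of f T 0 s "- ?k"] per by simp
    show "s + of_int (- ?k) * T \<in> {t..<t + T}"
      using \<open>T > 0\<close> floor_divide_lower[of T "s - t"] floor_divide_upper[of T "s - t"]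
      by (simp add: algebra_simps)
  qed
  then show ?thesis by auto
qed

lemma surj_quasiperiodic:
  fixes \<phi> :: "real \<Rightarrow> real"
  assumes cont: "continuous_on UNIV \<phi>" and "T > 0" "c > 0"
    and per: "\<And>t. \<phi> (t + T) = \<phi> t + c"
  shows "surj \<phi>"
  unfolding surj_def
proof
  fix y
  obtain n :: nat where n: "\<bar>y - \<phi> 0\<bar> < real n * c"
    using reals_Archimedean3[OF \<open>c > 0\<close>] by blast
  have "\<phi> (0 + of_int (int n) * T) = \<phi> 0 + of_int (int n) *\<^sub>R c"
       "\<phi> (0 + of_int (- int n) * T) = \<phi> 0 + of_int (- int n) *\<^sub>R c"
    by (rule quasiperiodic_shift[of \<phi> T c, OF per])+
  then have "\<phi> (- (n * T)) \<le> y" "y \<le> \<phi> (n * T)"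
    using n by (auto simp: algebra_simps abs_if split: if_splits)
  moreover have "- (n * T) \<le> n * T" using \<open>T > 0\<close> by simp
  moreover have "continuous_on {- (n * T)..n * T} \<phi>"
    using cont continuous_on_subset by blast
  ultimately show "\<exists>x. y = \<phi> x" using IVT'[of \<phi>] by metis
qed

text \<open>The functional \<open>a\<close> is the inner normal at \<open>t\<close>, so along the curve it has derivative
\<open>c l(s) sin (\<phi> s - \<phi> t)\<close>: it increases until the tangent has turned by \<open>\<pi>\<close>, and then decreases
back to its initial value at \<open>t + T\<close>.\<close>

lemma linear_functional_min_on_turning_curve:
  fixes \<gamma> :: "real \<Rightarrow> complex" and l \<phi> :: "real \<Rightarrow> real"
  assumes deriv: "\<And>t. (\<gamma> has_vector_derivative of_real (l t) * cis (\<phi> t)) (at t)"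
    and pos: "\<And>t. l t > 0"
    and mono: "strict_mono \<phi>" and cont: "continuous_on UNIV \<phi>"
    and "T > 0" and per: "\<And>t. \<gamma> (t + T) = \<gamma> t"
    and turn: "\<And>t. \<phi> (t + T) = \<phi> t + 2 * pi"
    and "c > 0" and a: "a = of_real c * \<i> * cis (\<phi> t)"
    and s: "s \<in> {t<..<t + T}"
  shows "a \<bullet> \<gamma> t < a \<bullet> \<gamma> s"
proof -
  let ?p = "\<lambda>s. a \<bullet> \<gamma> s"
  have dp: "(?p has_real_derivative c * l s * sin (\<phi> s - \<phi> t)) (at s)" for s
  proof -
    have "a \<bullet> (of_real (l s) * cis (\<phi> s)) = c * l s * sin (\<phi> s - \<phi> t)"
      by (simp add: a inner_complex_def sin_diff algebra_simps)
    then show ?thesis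
      using bounded_linear.has_vector_derivative[OF bounded_linear_inner_right deriv, of a s]
      by (simp add: has_real_derivative_iff_has_vector_derivative)
  qed
  then have contp: "continuous_on S ?p" for S
    by (meson DERIV_isCont continuous_at_imp_continuous_on)
  obtain u where u: "\<phi> u = \<phi> t + pi"
    using surj_quasiperiodic[of \<phi> T "2 * pi", OF cont \<open>T > 0\<close> _ turn] by (metis surjD pi_gt_zero mult_pos_pos zero_less_numeral)
  have less: "x < y \<longleftrightarrow> \<phi> x < \<phi> y" for x y
    using mono by (simp add: strict_mono_less)
  show ?thesis
  proof (cases "s \<le> u")
    case True
    show ?thesis
    proof (rule DERIV_pos_imp_increasing_open[of t s ?p])
      fix x assume x: "t < x" "x < s"
      then have "sin (\<phi> x - \<phi> t) > 0"
        using True u less[of t x] less[of x u] by (intro sin_gt_zero) auto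
      then show "\<exists>y. (?p has_real_derivative y) (at x) \<and> 0 < y"
        using dp pos \<open>c > 0\<close> by (meson mult_pos_pos)
    qed (use s contp in auto)
  next
    case False
    have "?p (t + T) < ?p s"
    proof (rule DERIV_neg_imp_decreasing_open[of s "t + T" ?p])
      fix x assume x: "s < x" "x < t + T"
      then have "sin (\<phi> x - \<phi> t) < 0"
        using False turn[of t] u less[of u x] less[of x "t + T"] by (intro sin_lt_zero) auto
      then show "\<exists>y. (?p has_real_derivative y) (at x) \<and> y < 0"
        using dp pos \<open>c > 0\<close> by (meson mult_pos_pos mult_pos_neg)
    qed (use s contp in auto)
    then show ?thesis by (simp add: per)
  qed
qed

text \<open>The domain bounded by the curve is the interior of its convex hull \<open>K\<close>. A point of the curve lies
on the frontier of \<open>K\<close> since the tangent there supports \<open>K\<close>. Conversely, a frontier point of \<open>K\<close>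
has a supporting line; its normal is the inner normal of the curve at some \<open>t\<close>, and this line meets
\<open>K\<close> only in \<open>\<gamma> t\<close>.\<close>

lemma convex_curve_turning_once:
  fixes \<gamma> :: "real \<Rightarrow> complex" and l \<phi> :: "real \<Rightarrow> real"
  assumes deriv: "\<And>t. (\<gamma> has_vector_derivative of_real (l t) * cis (\<phi> t)) (at t)"
    and pos: "\<And>t. l t > 0"
    and mono: "strict_mono \<phi>" and cont: "continuous_on UNIV \<phi>"
    and "T > 0" and per: "\<And>t. \<gamma> (t + T) = \<gamma> t"
    and turn: "\<And>t. \<phi> (t + T) = \<phi> t + 2 * pi"
  shows "convex_curve (range \<gamma>)"
proof -
  define K where "K = convex hull (range \<gamma>)"
  note min = linear_functional_min_on_turning_curve
      [where \<gamma> = \<gamma> and l = l and \<phi> = \<phi> and T = T, OF deriv pos mono cont \<open>T > 0\<close> per turn]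
  have period: "range \<gamma> = \<gamma> ` {t..<t + T}" for t
    by (rule range_periodic[of T \<gamma> t]) (use \<open>T > 0\<close> per in auto)
  have strict: "a \<bullet> \<gamma> t < a \<bullet> y"
    if "a = of_real c * \<i> * cis (\<phi> t)" "c > 0" "y \<in> range \<gamma>" "y \<noteq> \<gamma> t" for a c t y
  proof -
    have "y \<in> \<gamma> ` {t..<t + T}"
      using that(3) unfolding period[of t] .
    then obtain s where s: "y = \<gamma> s" "s \<in> {t..<t + T}"
      by blast
    then have "s \<in> {t<..<t + T}"
      using that(4) by (cases "s = t") auto
    then show ?thesis
      using min[OF that(2,1)] s(1) by blast
  qed
  have normal: "\<exists>t c. a = of_real c * \<i> * cis (\<phi> t) \<and> c > 0" if "a \<noteq> 0" for a
  proof -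
    obtain t where "\<phi> t = Arg (- \<i> * a)"
      using surj_quasiperiodic[of \<phi> T "2 * pi", OF cont \<open>T > 0\<close> _ turn] by (metis surjD pi_gt_zero mult_pos_pos zero_less_numeral)
    then have "of_real (norm a) * \<i> * cis (\<phi> t) = \<i> * rcis (norm (- \<i> * a)) (Arg (- \<i> * a))"
      by (simp add: rcis_def norm_mult)
    also have "\<dots> = a" by (simp only: rcis_cmod_Arg) simp
    finally show ?thesis using that by (metis zero_less_norm_iff)
  qed
  have other: "\<gamma> (t + T / 2) \<noteq> \<gamma> t" for t
    using min[of 1 "\<i> * cis (\<phi> t)" t "t + T / 2"] \<open>T > 0\<close> by auto
  have contg: "continuous_on S \<gamma>" for S
    using deriv by (meson has_vector_derivative_continuous continuous_at_imp_continuous_on)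
  have "compact (\<gamma> ` {0..T})"
    using contg by (simp add: compact_continuous_image)
  moreover have "\<gamma> ` {0..T} = range \<gamma>"
    using period[of 0] by fastforce
  ultimately have "compact K"
    unfolding K_def by (simp add: compact_convex_hull)
  have "convex K" unfolding K_def by simp
  have sub: "range \<gamma> \<subseteq> K" unfolding K_def by (rule hull_subset)
  \<comment> \<open>A hull without interior would lie on a line, on which the functional normal to it is constant.\<close>
  have int: "interior K \<noteq> {}"
  proof
    assume "interior K = {}"
    then obtain a b where ab: "a \<noteq> 0" "K \<subseteq> {x. a \<bullet> x = b}"
      using empty_interior_subset_hyperplane[OF \<open>convex K\<close>] by blast
    obtain t c where "a = of_real c * \<i> * cis (\<phi> t)" "c > 0"
      using normal ab by blast
    then have "a \<bullet> \<gamma> t < a \<bullet> \<gamma> (t + T / 2)"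
      using strict other by blast
    moreover have "a \<bullet> \<gamma> s = b" for s
      using ab(2) sub by auto
    ultimately show False by simp
  qed
  have front: "frontier K = K - interior K"
    using \<open>compact K\<close> by (simp add: frontier_def compact_imp_closed)
  have "x \<in> range \<gamma>" if x: "x \<in> frontier K" for x
  proof -
    have "x \<in> K" "x \<notin> rel_interior K"
      using x front rel_interior_nonempty_interior[OF int] by auto
    then obtain a where a: "a \<noteq> 0" "\<And>y. y \<in> K \<Longrightarrow> a \<bullet> x \<le> a \<bullet> y"
      using supporting_hyperplane_rel_boundary[OF \<open>convex K\<close>] by metis
    obtain t c where t: "a = of_real c * \<i> * cis (\<phi> t)" "c > 0"
      using normal a by blast
    \<comment> \<open>Strict support at \<open>\<gamma> t\<close>: the open half-plane stays convex after adding one boundary point.\<close>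
    let ?H = "insert (\<gamma> t) {y. a \<bullet> y > a \<bullet> \<gamma> t}"
    have "convex ?H"
    proof (rule convexI)
      fix y z :: complex and u v :: real
      assume h: "y \<in> ?H" "z \<in> ?H" "0 \<le> u" "0 \<le> v" "u + v = 1"
      consider "u = 0" "v = 1" | "u = 1" "v = 0" | "y = \<gamma> t" "z = \<gamma> t"
        | "u > 0" "v > 0" "y \<noteq> \<gamma> t \<or> z \<noteq> \<gamma> t"
        using h(3-5) by fastforce
      then show "u *\<^sub>R y + v *\<^sub>R z \<in> ?H"
      proof cases
        case 3
        then show ?thesis
          using h(5) by (simp add: scaleR_left_distrib[symmetric])
      next
        case 4
        have "a \<bullet> \<gamma> t = u * (a \<bullet> \<gamma> t) + v * (a \<bullet> \<gamma> t)"
          using h(5) by (simp add: distrib_right[symmetric])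
        also have "\<dots> < u * (a \<bullet> y) + v * (a \<bullet> z)"
          using 4 h(1,2) by (auto intro: add_strict_mono add_less_le_mono add_le_less_mono)
        finally show ?thesis by (simp add: inner_add_right)
      qed (use h(1,2) in simp_all)
    qed
    moreover have "range \<gamma> \<subseteq> ?H" using strict[OF t] by blast
    ultimately have "K \<subseteq> ?H" unfolding K_def by (simp add: hull_minimal)
    moreover have "a \<bullet> x \<le> a \<bullet> \<gamma> t" using a sub by blast
    ultimately show ?thesis using \<open>x \<in> K\<close> by auto
  qed
  moreover have "\<gamma> t \<in> frontier K" for t
  proof -
    define a where "a = \<i> * cis (\<phi> t)"
    have "range \<gamma> \<subseteq> {y. a \<bullet> y \<ge> a \<bullet> \<gamma> t}"
    proof
      fix y assume "y \<in> range \<gamma>"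
      then show "y \<in> {y. a \<bullet> y \<ge> a \<bullet> \<gamma> t}"
        using strict[of a 1 t y] by (cases "y = \<gamma> t") (auto simp: a_def)
    qed
    then have "K \<subseteq> {y. a \<bullet> y \<ge> a \<bullet> \<gamma> t}"
      unfolding K_def by (simp add: hull_minimal convex_halfspace_ge)
    moreover have "interior {y. a \<bullet> y \<ge> a \<bullet> \<gamma> t} = {y. a \<bullet> y > a \<bullet> \<gamma> t}"
      by (rule interior_halfspace_ge) (simp add: a_def)
    ultimately have "\<gamma> t \<notin> interior K"
      using interior_mono by blast
    then show ?thesis using front sub by auto
  qed
  ultimately have "range \<gamma> = frontier K" by blast
  also have "\<dots> = frontier (interior K)"
    using convex_closure_interior[OF \<open>convex K\<close> int] by (simp add: frontier_def)
  finally show ?thesis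
    unfolding convex_curve_def using \<open>convex K\<close> int \<open>compact K\<close>
    by (metis open_interior convex_interior bounded_interior compact_imp_bounded)
qed

section \<open>Harmonic functions as sums of holomorphic and antiholomorphic functions\<close>

text \<open>Differentiating \<open>u p + v cnj q\<close> in \<open>x\<close> and \<open>y\<close> gives \<open>u p' + v cnj q'\<close> and
\<open>\<i> u p' - \<i> v cnj q'\<close>. Both have the original form, so one computation serves for the first and the
second derivatives; applying the second rule twice changes the sign, whence the Laplace equation.\<close>

lemma harmonic_on_holomorphic_plus_cnj:
  assumes "h holomorphic_on S" "g holomorphic_on S" "open S"
    and f: "\<And>z. z \<in> S \<Longrightarrow> f z = h z + cnj (g z)"
  shows "harmonic_on f S"
proof -
  have part: "((\<lambda>z. u * p z + v * cnj (q z)) has_derivative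
      (\<lambda>w. Re w *\<^sub>R (u * deriv p z + v * cnj (deriv q z))
         + Im w *\<^sub>R (\<i> * u * deriv p z - \<i> * v * cnj (deriv q z)))) (at z)"
    if "p holomorphic_on S" "q holomorphic_on S" "z \<in> S" for p q u v z
  proof -
    have d: "(p has_derivative (*) (deriv p z)) (at z)"
         "(q has_derivative (*) (deriv q z)) (at z)"
      using that holomorphic_derivI[OF _ \<open>open S\<close>]
      unfolding has_field_derivative_def by blast+
    have "((\<lambda>z. u * p z + v * cnj (q z)) has_derivative
        (\<lambda>w. u * (deriv p z * w) + v * cnj (deriv q z * w))) (at z)"
      by (intro has_derivative_add has_derivative_mult_right d
          bounded_linear.has_derivative[OF bounded_linear_cnj])
    also have "(\<lambda>w. u * (deriv p z * w) + v * cnj (deriv q z * w))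
      = (\<lambda>w. Re w *\<^sub>R (u * deriv p z + v * cnj (deriv q z))
         + Im w *\<^sub>R (\<i> * u * deriv p z - \<i> * v * cnj (deriv q z)))"
      by (simp add: fun_eq_iff complex_eq_iff algebra_simps)
    finally show ?thesis .
  qed
  have hol: "deriv h holomorphic_on S" "deriv g holomorphic_on S"
    "deriv (deriv h) holomorphic_on S" "deriv (deriv g) holomorphic_on S"
    using assms holomorphic_deriv by blast+
  define P where "P u v z = u * deriv (deriv h) z + v * cnj (deriv (deriv g) z)" for u v z
  have cP: "continuous_on S (P u v)" for u v
    unfolding P_def[abs_def] using hol
    by (intro continuous_intros holomorphic_on_imp_continuous_on)
  have sum0: "P 1 1 z + P (- 1) (- 1) z = 0" for z
    by (simp add: P_def)
  have df: "(f has_derivative (\<lambda>w. Re w *\<^sub>R (deriv h z + cnj (deriv g z))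
      + Im w *\<^sub>R (\<i> * deriv h z + (- \<i>) * cnj (deriv g z)))) (at z)" if "z \<in> S" for z
    by (rule has_derivative_transform_within_open[OF _ \<open>open S\<close> that f[symmetric]])
       (use part[OF assms(1,2) that, of 1 1] in simp)
  show ?thesis
    unfolding harmonic_on_def
  proof (intro conjI exI ballI)
    show "(f has_derivative (\<lambda>w. Re w *\<^sub>R (deriv h z + cnj (deriv g z))
      + Im w *\<^sub>R (\<i> * deriv h z + (- \<i>) * cnj (deriv g z)))) (at z)" if "z \<in> S" for z
      using df that .
    show "((\<lambda>z. deriv h z + cnj (deriv g z)) has_derivative
        (\<lambda>w. Re w *\<^sub>R P 1 1 z + Im w *\<^sub>R P \<i> (- \<i>) z)) (at z)" if "z \<in> S" for z
      using part[OF hol(1,2) that, of 1 1] by (simp add: P_def)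
    show "((\<lambda>z. \<i> * deriv h z + (- \<i>) * cnj (deriv g z)) has_derivative
        (\<lambda>w. Re w *\<^sub>R P \<i> (- \<i>) z + Im w *\<^sub>R P (- 1) (- 1) z)) (at z)" if "z \<in> S" for z
      using part[OF hol(1,2) that, of \<i> "- \<i>"] by (simp add: P_def)
  qed (auto simp: cP sum0 \<open>open S\<close>)
qed

section \<open>Full convexity from a coefficient inequality\<close>

text \<open>The half-plane \<open>Re w > \<alpha>\<close> consists of the points \<open>w\<close> that are closer to \<open>1\<close> than to its mirror
image \<open>2 \<alpha> - 1\<close>.\<close>

lemma Re_divide_gt:
  fixes N D :: complex
  assumes "norm (N - D) < norm (N + of_real (1 - 2 * \<alpha>) * D)" "\<alpha> < 1"
  shows "Re (N / D) > \<alpha>"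
proof -
  have D: "D \<noteq> 0" using assms by auto
  let ?w = "N / D"
  have "norm (?w - 1) * norm D < norm (?w + of_real (1 - 2 * \<alpha>)) * norm D"
    using assms D by (simp add: norm_mult[symmetric] algebra_simps)
  then have "norm (?w - 1) < norm (?w + of_real (1 - 2 * \<alpha>))"
    using D by simp
  then have "(norm (?w - 1))\<^sup>2 < (norm (?w + of_real (1 - 2 * \<alpha>)))\<^sup>2"
    by (simp add: power_strict_mono)
  then have "0 < 4 * (1 - \<alpha>) * (Re ?w - \<alpha>)"
    unfolding cmod_power2 by (simp add: power2_eq_square algebra_simps)
  then show ?thesis using assms(2) by (simp add: zero_less_mult_iff)
qed

definition coefficient_sum :: "real \<Rightarrow> (nat \<Rightarrow> complex) \<Rightarrow> (nat \<Rightarrow> complex) \<Rightarrow> real \<Rightarrow> real" where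
  "coefficient_sum \<alpha> a b r =
     powser (\<lambda>n. real n * (real n - \<alpha>) * norm (a n) + real n * (real n + \<alpha>) * norm (b n)) r"

lemma coefficient_sum_eq:
  assumes "unit_summable a" "unit_summable b" "0 \<le> r" "r < 1"
  shows "coefficient_sum \<alpha> a b r
    = powser (euler (euler (\<lambda>n. norm (a n)))) r - \<alpha> * powser (euler (\<lambda>n. norm (a n))) r
    + (powser (euler (euler (\<lambda>n. norm (b n)))) r + \<alpha> * powser (euler (\<lambda>n. norm (b n))) r)"
proof -
  note ca = powser_euler_combination[OF unit_summable_norm[OF assms(1)], of r "- \<alpha>"]
  note cb = powser_euler_combination[OF unit_summable_norm[OF assms(2)], of r \<alpha>]
  have "coefficient_sum \<alpha> a b r
      = powser (\<lambda>n. real n * (real n + - \<alpha>) * norm (a n)) r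
      + powser (\<lambda>n. real n * (real n + \<alpha>) * norm (b n)) r"
    using ca(1) cb(1) assms(3,4)
    by (simp add: coefficient_sum_def powser_def unit_summable_def suminf_add distrib_right)
  then show ?thesis using ca(2) cb(2) assms(3,4) by simp
qed

text \<open>Compare the weights: \<open>(1 - \<alpha>) n \<le> n (n - \<alpha>)\<close> and \<open>(1 - \<alpha>) n \<le> n (n + \<alpha>)\<close>.\<close>

lemma euler_sums_less_radius:
  assumes "0 \<le> \<alpha>" "\<alpha> < 1" "unit_summable a" "unit_summable b" "0 \<le> r" "r < 1"
    and "coefficient_sum \<alpha> a b r < (1 - \<alpha>) * r"
  shows "powser (euler (\<lambda>n. norm (a n))) r + powser (euler (\<lambda>n. norm (b n))) r < r"
proof -
  let ?X1 = "powser (euler (\<lambda>n. norm (a n))) r" and ?Y1 = "powser (euler (\<lambda>n. norm (b n))) r"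
  let ?X2 = "powser (euler (euler (\<lambda>n. norm (a n)))) r"
  let ?Y2 = "powser (euler (euler (\<lambda>n. norm (b n)))) r"
  have "?X1 \<le> ?X2" "?Y1 \<le> ?Y2"
    using order_trans[OF norm_ge_zero norm_powser_euler_combination_le[of a 0 r "-1"]]
      order_trans[OF norm_ge_zero norm_powser_euler_combination_le[of b 0 r "-1"]] assms
    by simp_all
  moreover have "0 \<le> ?Y1"
    using order_trans[OF norm_ge_zero norm_powser_euler_le[of b 0 r]] assms by simp
  then have "0 \<le> \<alpha> * ?Y1" using assms by simp
  moreover have "?X2 - \<alpha> * ?X1 + (?Y2 + \<alpha> * ?Y1) < (1 - \<alpha>) * r"
    using assms coefficient_sum_eq by simp
  ultimately have "(1 - \<alpha>) * (?X1 + ?Y1) < (1 - \<alpha>) * r"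
    using \<open>0 \<le> \<alpha> * ?Y1\<close> by (simp add: algebra_simps)
  then show ?thesis using assms(2) by simp
qed

text \<open>In the proof, \<open>\<i> D\<close> is the derivative of the curve and \<open>\<i> N\<close> that of \<open>D\<close>. The angle \<open>\<phi>\<close> is that of
the tangent \<open>\<i> z\<close> to the circle, corrected by the argument of \<open>q = D cis (- t)\<close>. Since \<open>q\<close> stays
within distance \<open>r\<close> of \<open>r\<close>, the principal branch applies, and since \<open>q\<close> is periodic, \<open>\<phi>\<close> gains
\<open>2 \<pi>\<close> over a period.\<close>

lemma circle_tangent_angle:
  fixes f :: "complex \<Rightarrow> complex"
  assumes "0 \<le> \<alpha>" "\<alpha> < 1" and a: "unit_summable a" and b: "unit_summable b"
    and r: "0 < r" "r < 1"
    and coeff: "coefficient_sum \<alpha> a b r < (1 - \<alpha>) * r"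
    and f: "\<And>z. norm z = r \<Longrightarrow> f z = z + powser a z + cnj (powser b z)"
  obtains l \<phi> \<phi>' where
    "\<And>t. ((\<lambda>t. f (of_real r * cis t)) has_vector_derivative of_real (l t) * cis (\<phi> t)) (at t)"
    "\<And>t. l t > 0" "\<And>t. (\<phi> has_real_derivative \<phi>' t) (at t)" "\<And>t. \<phi>' t > \<alpha>"
    "\<And>t. \<phi> (t + 2 * pi) = \<phi> t + 2 * pi"
proof -
  define Z where "Z t = of_real r * cis t" for t
  define D where "D t = Z t + powser (euler a) (Z t) - cnj (powser (euler b) (Z t))" for t
  define N where "N t = Z t + powser (euler (euler a)) (Z t) + cnj (powser (euler (euler b)) (Z t))" for t
  define q where "q t = D t * cis (- t)" for t
  have tri: "norm (x + cnj y) \<le> norm x + norm y" for x y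
    using norm_triangle_ineq[of x "cnj y"] by simp
  define \<phi> where "\<phi> t = pi / 2 + t + Im (Ln (q t))" for t
  have nZ: "norm (Z t) = r" for t using r by (simp add: Z_def norm_mult)
  note eul = unit_summable_euler
  have dcis: "((\<lambda>t. cis (c * t)) has_vector_derivative of_real c * \<i> * cis (c * t)) (at t)" for c t
    by (auto intro!: derivative_eq_intros simp: has_vector_derivative_def scaleR_conv_of_real algebra_simps)
  have dZ: "(Z has_vector_derivative \<i> * Z t) (at t)" for t
    using has_vector_derivative_mult_right[OF dcis[of 1 t], of "of_real r"]
    by (simp add: Z_def[abs_def] mult_ac)
  have dp: "((\<lambda>t. powser c (Z t)) has_vector_derivative \<i> * powser (euler c) (Z t)) (at t)"
    if "unit_summable c" for c t
    unfolding Z_def using powser_polar_deriv[OF that, of r t] r by simp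
  have dG: "((\<lambda>t. f (of_real r * cis t)) has_vector_derivative \<i> * D t) (at t)" for t
  proof -
    have "((\<lambda>t. Z t + powser a (Z t) + cnj (powser b (Z t))) has_vector_derivative
        \<i> * Z t + \<i> * powser (euler a) (Z t) + cnj (\<i> * powser (euler b) (Z t))) (at t)"
      by (intro has_vector_derivative_add has_vector_derivative_cnj dZ dp a b)
    moreover have "f (of_real r * cis t) = Z t + powser a (Z t) + cnj (powser b (Z t))" for t
      using f[OF nZ] by (simp add: Z_def)
    ultimately show ?thesis by (simp add: D_def algebra_simps)
  qed
  have dD: "(D has_vector_derivative \<i> * N t) (at t)" for t
  proof -
    have "(D has_vector_derivative \<i> * Z t + \<i> * powser (euler (euler a)) (Z t)
        - cnj (\<i> * powser (euler (euler b)) (Z t))) (at t)"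
      unfolding D_def[abs_def]
      by (intro has_vector_derivative_add has_vector_derivative_diff
          has_vector_derivative_cnj dZ dp eul a b)
    then show ?thesis by (simp add: N_def algebra_simps)
  qed
  have dq: "(q has_vector_derivative \<i> * (N t - D t) * cis (- t)) (at t)" for t
  proof -
    have "(q has_vector_derivative D t * (- \<i> * cis (- t)) + \<i> * N t * cis (- t)) (at t)"
      unfolding q_def[abs_def]
      using has_vector_derivative_mult[OF dD dcis[of "-1" t]] by simp
    then show ?thesis by (simp add: algebra_simps)
  qed
  have Req: "Re (q t) > 0" for t
  proof -
    have "norm (D t - Z t) \<le> norm (powser (euler a) (Z t)) + norm (powser (euler b) (Z t))"
      using norm_triangle_ineq4[of "powser (euler a) (Z t)" "cnj (powser (euler b) (Z t))"]
      by (simp add: D_def)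
    also have "\<dots> \<le> powser (euler (\<lambda>n. norm (a n))) r + powser (euler (\<lambda>n. norm (b n))) r"
      using a b r nZ by (intro add_mono norm_powser_euler_le) auto
    also have "\<dots> < r"
      using euler_sums_less_radius assms by simp
    finally have "norm ((D t - Z t) * cis (- t)) < r" by (simp add: norm_mult)
    moreover have "(D t - Z t) * cis (- t) = q t - of_real r"
      by (simp add: q_def Z_def left_diff_distrib cis_mult)
    ultimately have "\<bar>Re (q t - of_real r)\<bar> < r"
      using abs_Re_le_cmod le_less_trans by metis
    then show ?thesis by simp
  qed
  have D0: "D t \<noteq> 0" for t using Req[of t] by (auto simp: q_def)
  have "(\<phi> has_real_derivative Re (N t / D t)) (at t)" for t
  proof -
    have "q t \<notin> \<real>\<^sub>\<le>\<^sub>0" using Req[of t] complex_nonpos_Reals_iff by auto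
    then have "(Ln has_field_derivative inverse (q t)) (at (q t))"
      by (rule has_field_derivative_Ln)
    from bounded_linear.has_vector_derivative[OF bounded_linear_Im
        field_vector_diff_chain_at[OF dq this]]
    have "((\<lambda>t. Im (Ln (q t))) has_real_derivative
        Im (\<i> * (N t - D t) * cis (- t) * inverse (q t))) (at t)"
      by (simp only: o_def has_real_derivative_iff_has_vector_derivative)
    also have "\<i> * (N t - D t) * cis (- t) * inverse (q t) = \<i> * (N t / D t - 1)"
      using D0[of t] by (simp add: q_def divide_simps)
    finally have "(\<phi> has_real_derivative 0 + 1 + Im (\<i> * (N t / D t - 1))) (at t)"
      unfolding \<phi>_def[abs_def] by (intro DERIV_add DERIV_const DERIV_ident)
    then show ?thesis by simp
  qed
  moreover have "Re (N t / D t) > \<alpha>" for t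
  proof (rule Re_divide_gt[OF _ \<open>\<alpha> < 1\<close>])
    let ?A1 = "powser (euler a) (Z t)" and ?A2 = "powser (euler (euler a)) (Z t)"
    let ?B1 = "powser (euler b) (Z t)" and ?B2 = "powser (euler (euler b)) (Z t)"
    let ?X1 = "powser (euler (\<lambda>n. norm (a n))) r" and ?Y1 = "powser (euler (\<lambda>n. norm (b n))) r"
    let ?X2 = "powser (euler (euler (\<lambda>n. norm (a n)))) r"
    let ?Y2 = "powser (euler (euler (\<lambda>n. norm (b n)))) r"
    have est: "norm (?A2 + of_real \<beta> * ?A1) \<le> ?X2 + \<beta> * ?X1"
        "norm (?B2 + of_real \<beta> * ?B1) \<le> ?Y2 + \<beta> * ?Y1" if "\<beta> \<ge> -1" for \<beta>
      using norm_powser_euler_combination_le a b nZ r that by auto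
    let ?E = "(?A2 + of_real (1 - 2 * \<alpha>) * ?A1) + cnj (?B2 + of_real (2 * \<alpha> - 1) * ?B1)"
    have "N t - D t = (?A2 + of_real (- 1) * ?A1) + cnj (?B2 + of_real 1 * ?B1)"
      by (simp add: N_def D_def)
    then have "norm (N t - D t) \<le> norm (?A2 + of_real (- 1) * ?A1) + norm (?B2 + of_real 1 * ?B1)"
      by (metis tri)
    also have "\<dots> \<le> (?X2 - ?X1) + (?Y2 + ?Y1)"
      using est(1)[of "-1"] est(2)[of 1] by simp
    \<comment> \<open>The weights \<open>n (n - 1)\<close> and \<open>n (n + 1 - 2 \<alpha>)\<close> add up to \<open>2 n (n - \<alpha>)\<close>; likewise for \<open>b\<close>.\<close>
    also have "\<dots> = 2 * coefficient_sum \<alpha> a b r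
        - ((?X2 + (1 - 2 * \<alpha>) * ?X1) + (?Y2 + (2 * \<alpha> - 1) * ?Y1))"
      using coefficient_sum_eq[OF a b, of r \<alpha>] r by (simp add: algebra_simps)
    also have "\<dots> < 2 * (1 - \<alpha>) * r
        - ((?X2 + (1 - 2 * \<alpha>) * ?X1) + (?Y2 + (2 * \<alpha> - 1) * ?Y1))"
      using coeff by (simp add: algebra_simps)
    also have "\<dots> \<le> norm (of_real (2 * (1 - \<alpha>)) * Z t) - norm ?E"
    proof -
      have "norm ?E \<le> norm (?A2 + of_real (1 - 2 * \<alpha>) * ?A1) + norm (?B2 + of_real (2 * \<alpha> - 1) * ?B1)"
        by (rule tri)
      then have "norm ?E \<le> (?X2 + (1 - 2 * \<alpha>) * ?X1) + (?Y2 + (2 * \<alpha> - 1) * ?Y1)"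
        using est(1)[of "1 - 2 * \<alpha>"] est(2)[of "2 * \<alpha> - 1"] assms(1,2) by linarith
      moreover have "norm (of_real (2 * (1 - \<alpha>)) * Z t) = 2 * (1 - \<alpha>) * r"
        unfolding norm_mult norm_of_real nZ using assms(2) by simp
      ultimately show ?thesis by linarith
    qed
    also have "\<dots> \<le> norm (of_real (2 * (1 - \<alpha>)) * Z t + ?E)"
      by (rule norm_diff_ineq)
    also have "of_real (2 * (1 - \<alpha>)) * Z t + ?E = N t + of_real (1 - 2 * \<alpha>) * D t"
      by (simp add: N_def D_def algebra_simps)
    finally show "norm (N t - D t) < norm (N t + of_real (1 - 2 * \<alpha>) * D t)" .
  qed
  moreover have "\<phi> (t + 2 * pi) = \<phi> t + 2 * pi" for t
  proof -
    have "cis (t + 2 * pi) = cis t" by (simp add: complex_eq_iff)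
    moreover from this have "cis (- (t + 2 * pi)) = cis (- t)" by (metis cis_cnj)
    ultimately have "q (t + 2 * pi) = q t" unfolding q_def D_def Z_def by simp
    then show ?thesis by (simp add: \<phi>_def)
  qed
  moreover have "((\<lambda>t. f (of_real r * cis t)) has_vector_derivative
      of_real (norm (D t)) * cis (\<phi> t)) (at t)" for t
  proof -
    have "q t \<noteq> 0" using D0 by (simp add: q_def)
    then have "q t = of_real (norm (q t)) * cis (Im (Ln (q t)))"
      by (metis exp_Ln exp_eq_polar norm_exp_eq_Re)
    moreover have "norm (q t) = norm (D t)" by (simp add: q_def norm_mult)
    moreover have "D t = q t * cis t" by (simp add: q_def mult.assoc cis_mult)
    moreover have "cis (\<phi> t) = \<i> * cis t * cis (Im (Ln (q t)))"
      by (simp only: \<phi>_def cis_mult[symmetric] cis_pi_half)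
    ultimately have "\<i> * D t = of_real (norm (D t)) * cis (\<phi> t)"
      by (metis mult.assoc mult.commute)
    then show ?thesis using dG[of t] by simp
  qed
  ultimately show thesis
    using D0 by (intro that[of "\<lambda>t. norm (D t)" \<phi> "\<lambda>t. Re (N t / D t)"]) auto
qed

lemma polar_image: "0 \<le> r \<Longrightarrow> range (\<lambda>t. of_real r * cis t) = sphere 0 r"
proof (intro equalityI subsetI)
  fix z :: complex assume "0 \<le> r" "z \<in> sphere 0 r"
  then have "z = of_real r * cis (Arg z)"
    using rcis_cmod_Arg[of z] by (simp add: rcis_def)
  then show "z \<in> range (\<lambda>t. of_real r * cis t)" by blast
qed (auto simp: norm_mult)

theorem fully_convex_order_of_coefficient_sum:
  assumes \<alpha>: "0 \<le> \<alpha>" "\<alpha> < 1" and a: "unit_summable a" and b: "unit_summable b"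
    and "\<rho> \<le> 1"
    and coeff: "\<And>r. 0 < r \<Longrightarrow> r < \<rho> \<Longrightarrow> coefficient_sum \<alpha> a b r < (1 - \<alpha>) * r"
    and f: "\<And>z. norm z < \<rho> \<Longrightarrow> f z = z + powser a z + cnj (powser b z)"
  shows "inj_on f (ball 0 \<rho>)" "fully_convex_order \<alpha> \<rho> f"
proof -
  show inj: "inj_on f (ball 0 \<rho>)"
  proof (rule inj_onI, rule ccontr)
    fix z w assume zw: "z \<in> ball 0 \<rho>" "w \<in> ball 0 \<rho>" "f z = f w" "z \<noteq> w"
    define r where "r = max (norm z) (norm w)"
    have r: "0 < r" "r < \<rho>" "norm z \<le> r" "norm w \<le> r" "r < 1"
      using zw \<open>\<rho> \<le> 1\<close> by (auto simp: r_def less_max_iff_disj)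
    let ?X1 = "powser (euler (\<lambda>n. norm (a n))) r" and ?Y1 = "powser (euler (\<lambda>n. norm (b n))) r"
    have "z - w = - (powser a z - powser a w) - cnj (powser b z - powser b w)"
      using zw f by (simp add: algebra_simps)
    then have "norm (z - w) = norm (- (powser a z - powser a w) - cnj (powser b z - powser b w))"
      by (rule arg_cong)
    also have "\<dots> \<le> norm (- (powser a z - powser a w)) + norm (cnj (powser b z - powser b w))"
      by (rule norm_triangle_ineq4)
    finally have "norm (z - w) \<le> norm (powser a z - powser a w) + norm (powser b z - powser b w)"
      unfolding norm_minus_cancel complex_mod_cnj .
    then have "r * norm (z - w)
        \<le> r * norm (powser a z - powser a w) + r * norm (powser b z - powser b w)"
      using r by (simp flip: distrib_left)
    also have "\<dots> \<le> (?X1 + ?Y1) * norm (z - w)"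
      unfolding distrib_right using a b r by (intro add_mono norm_powser_diff_le)
    also have "\<dots> < r * norm (z - w)"
      using euler_sums_less_radius[OF \<alpha> a b _ _ coeff] r zw(4) by simp
    finally show False by simp
  qed
  show "fully_convex_order \<alpha> \<rho> f"
    unfolding fully_convex_order_def
  proof (intro conjI allI impI)
    have sub: "ball 0 \<rho> \<subseteq> ball (0::complex) 1" using \<open>\<rho> \<le> 1\<close> by auto
    show "harmonic_on f (ball 0 \<rho>)"
    proof (rule harmonic_on_holomorphic_plus_cnj)
      show "(\<lambda>z. z + powser a z) holomorphic_on ball 0 \<rho>"
        by (intro holomorphic_intros holomorphic_on_subset[OF powser_holomorphic sub] a)
      show "powser b holomorphic_on ball 0 \<rho>"
        by (intro holomorphic_on_subset[OF powser_holomorphic sub] b)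
    qed (use f in auto)
  next
    fix r assume r: "0 < r \<and> r < \<rho>"
    then have r1: "0 < r" "r < 1" using \<open>\<rho> \<le> 1\<close> by auto
    show "inj_on f (sphere 0 r)"
      by (rule inj_on_subset[OF inj]) (use r in auto)
    let ?\<gamma> = "\<lambda>t. f (of_real r * cis t)"
    have fr: "\<And>z. norm z = r \<Longrightarrow> f z = z + powser a z + cnj (powser b z)"
      using f r by auto
    obtain l \<phi> \<phi>' where
      d: "\<And>t. (?\<gamma> has_vector_derivative of_real (l t) * cis (\<phi> t)) (at t)"
      and l: "\<And>t. l t > 0" and d\<phi>: "\<And>t. (\<phi> has_real_derivative \<phi>' t) (at t)"
      and gt: "\<And>t. \<phi>' t > \<alpha>" and turn: "\<And>t. \<phi> (t + 2 * pi) = \<phi> t + 2 * pi"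
      by (rule circle_tangent_angle[OF \<alpha> a b r1 coeff fr]) (use r in auto)
    have "strict_mono \<phi>"
    proof (rule strict_monoI)
      show "\<phi> x < \<phi> y" if "x < y" for x y
        using DERIV_pos_imp_increasing[OF that, of \<phi>] d\<phi> gt \<alpha>(1) by (meson le_less_trans)
    qed
    moreover have "continuous_on UNIV \<phi>"
      using d\<phi> by (meson DERIV_isCont continuous_at_imp_continuous_on)
    moreover have "?\<gamma> (t + 2 * pi) = ?\<gamma> t" for t
    proof -
      have "cis (t + 2 * pi) = cis t" by (simp add: complex_eq_iff)
      then show ?thesis by simp
    qed
    ultimately have "convex_curve (range ?\<gamma>)"
      using convex_curve_turning_once[of ?\<gamma> l \<phi> "2 * pi"] d l turn by simp
    moreover have "range ?\<gamma> = f ` sphere 0 r"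
    proof -
      have "range ?\<gamma> = f ` range (\<lambda>t. of_real r * cis t)"
        by (rule image_image[symmetric])
      then show ?thesis using polar_image[of r] r by simp
    qed
    ultimately show "convex_curve (f ` sphere 0 r)" by simp
    show "tangent_arg_deriv_gt \<alpha> ?\<gamma>"
      unfolding tangent_arg_deriv_gt_def
    proof (intro exI conjI allI ballI)
      show "(?\<gamma> has_vector_derivative of_real (l t) * cis (\<phi> t)) (at t)" for t by (rule d)
      show "of_real (l t) * cis (\<phi> t) \<noteq> 0" for t using l[of t] by simp
      show "of_real (l t) * cis (\<phi> t) = of_real (norm (of_real (l t) * cis (\<phi> t))) * cis (\<phi> t)" for t
        using l[of t] by (simp add: norm_mult)
    qed (use d\<phi> gt in auto)
  qed
qed

section \<open>The radius for the extremal coefficients\<close>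

text \<open>The series with coefficients \<open>n\<^sup>2\<close> and \<open>n\<^sup>4\<close>, obtained by applying the operator \<open>r d/dr\<close> repeatedly to
the geometric series.\<close>

lemma geometric_euler_closed_forms:
  fixes r :: real
  assumes "\<bar>r\<bar> < 1"
  defines "one \<equiv> (\<lambda>_. 1) :: nat \<Rightarrow> real"
  shows "unit_summable one"
    "powser (euler (euler one)) r = r * (1 + r) / (1 - r)^3"
    "powser (euler (euler (euler (euler one)))) r
       = r * (1 + r) * (1 + 10 * r + r\<^sup>2) / (1 - r)^5"
proof -
  show us: "unit_summable one"
    by (simp add: unit_summable_def one_def summable_geometric)
  have step: "powser (euler c) x = x * F' x"
    if us: "unit_summable c" and F: "\<And>x. \<bar>x\<bar> < 1 \<Longrightarrow> powser c x = F x"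
      and F': "\<And>x. \<bar>x\<bar> < 1 \<Longrightarrow> (F has_real_derivative F' x) (at x)"
      and x: "\<bar>x\<bar> < 1" for c F F' and x :: real
  proof -
    obtain d where d: "(powser c has_field_derivative d) (at x)" "x * d = powser (euler c) x"
      using powser_has_field_derivative[OF us] x by auto
    have "(F has_field_derivative d) (at x)"
      by (rule has_field_derivative_transform_within_open[OF d(1), of "ball 0 1"])
         (use F x in auto)
    then show ?thesis using d(2) F' x DERIV_unique by metis
  qed
  have e0: "powser one x = 1 / (1 - x)" if "\<bar>x\<bar> < 1" for x
    using that by (simp add: powser_def one_def suminf_geometric)
  have e1: "powser (euler one) x = x / (1 - x)^2" if "\<bar>x\<bar> < 1" for x
    by (subst step[OF us e0, where F' = "\<lambda>x. 1 / (1 - x)^2"])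
       (use that in \<open>auto intro!: derivative_eq_intros simp: power2_eq_square\<close>)
  have e2: "powser (euler (euler one)) x = x * (1 + x) / (1 - x)^3" if "\<bar>x\<bar> < 1" for x
    by (subst step[OF unit_summable_euler[OF us] e1, where F' = "\<lambda>x. (1 + x) / (1 - x)^3"])
       (use that in \<open>auto intro!: derivative_eq_intros simp: divide_simps, simp add: algebra_simps power_numeral_reduce\<close>)
  have e3: "powser (euler (euler (euler one))) x = x * (1 + 4 * x + x^2) / (1 - x)^4"
    if "\<bar>x\<bar> < 1" for x
    by (subst step[OF unit_summable_euler[OF unit_summable_euler[OF us]] e2,
          where F' = "\<lambda>x. (1 + 4 * x + x^2) / (1 - x)^4"])
       (use that in \<open>auto intro!: derivative_eq_intros simp: divide_simps, simp add: algebra_simps power_numeral_reduce\<close>)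
  show "powser (euler (euler one)) r = r * (1 + r) / (1 - r)^3"
    using e2 assms by blast
  show "powser (euler (euler (euler (euler one)))) r
       = r * (1 + r) * (1 + 10 * r + r\<^sup>2) / (1 - r)^5"
    by (subst step[OF unit_summable_euler[OF unit_summable_euler[OF unit_summable_euler[OF us]]] e3,
          where F' = "\<lambda>x. (1 + x) * (1 + 10 * x + x^2) / (1 - x)^5"])
       (use assms in \<open>auto intro!: derivative_eq_intros simp: divide_simps, simp add: algebra_simps power_numeral_reduce\<close>)
qed

text \<open>The function \<open>(1 + r) (r\<^sup>2 + 4 r + 1 - \<alpha> (1 - r)\<^sup>2) / (1 - r)\<^sup>5\<close>, split into two terms by
\<open>r\<^sup>2 + 4 r + 1 = (1 - r)\<^sup>2 + 6 r\<close>. In this form both terms are visibly increasing on \<open>[0, 1)\<close>.\<close>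

definition majorant :: "real \<Rightarrow> real \<Rightarrow> real" where
  "majorant \<alpha> r = (1 - \<alpha>) * (1 + r) / (1 - r)^3 + 6 * r * (1 + r) / (1 - r)^5"

lemma is_s0_root_iff_majorant:
  "is_s0_root \<alpha> r \<longleftrightarrow> 0 < r \<and> r < 1 \<and> majorant \<alpha> r = 2 * (1 - \<alpha>)"
proof (cases "r = 1")
  case False
  have M: "(1 + r) * ((1 - \<alpha>) * (1 - r)^2 + 6 * r) = majorant \<alpha> r * (1 - r)^5"
  proof -
    have "(1 - \<alpha>) * (1 + r) / (1 - r)^3 * (1 - r)^5 = (1 - \<alpha>) * (1 + r) * (1 - r)^2"
      using False by (simp add: power_numeral_reduce)
    then show ?thesis
      using False by (simp add: majorant_def distrib_right) (simp add: algebra_simps)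
  qed
  have "2 * (1 - \<alpha>) * (1 - r)^5 + \<alpha> * (1 + r) * (1 - r)^2 - (1 + r) * (r^2 + 4 * r + 1)
      = 2 * (1 - \<alpha>) * (1 - r)^5 - (1 + r) * ((1 - \<alpha>) * (1 - r)^2 + 6 * r)"
    by (simp add: power2_eq_square algebra_simps)
  also have "\<dots> = (2 * (1 - \<alpha>) - majorant \<alpha> r) * (1 - r)^5"
    unfolding M by (rule left_diff_distrib[symmetric])
  finally have eq: "2 * (1 - \<alpha>) * (1 - r)^5 + \<alpha> * (1 + r) * (1 - r)^2
      - (1 + r) * (r^2 + 4 * r + 1) = (2 * (1 - \<alpha>) - majorant \<alpha> r) * (1 - r)^5" .
  show ?thesis
    unfolding is_s0_root_def eq using False by auto
qed (simp add: is_s0_root_def)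

lemma majorant_strict_mono:
  assumes "\<alpha> < 1" "0 \<le> r" "r < s" "s < 1"
  shows "majorant \<alpha> r < majorant \<alpha> s"
  unfolding majorant_def
proof (rule add_le_less_mono)
  show "(1 - \<alpha>) * (1 + r) / (1 - r)^3 \<le> (1 - \<alpha>) * (1 + s) / (1 - s)^3"
    using assms by (intro frac_le mult_left_mono power_mono mult_nonneg_nonneg) auto
  show "6 * r * (1 + r) / (1 - r)^5 < 6 * s * (1 + s) / (1 - s)^5"
  proof (rule frac_less)
    show "6 * r * (1 + r) < 6 * s * (1 + s)"
      by (rule mult_strict_mono) (use assms in auto)
  qed (use assms in \<open>auto intro!: power_mono\<close>)
qed

text \<open>At \<open>0\<close> the polynomial is \<open>1 - \<alpha> > 0\<close> and at \<open>1\<close> it is \<open>- 12\<close>, so it has a root; monotonicity of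
the majorant gives uniqueness.\<close>

lemma ex1_is_s0_root:
  assumes "0 \<le> \<alpha>" "\<alpha> < 1"
  shows "\<exists>!r. is_s0_root \<alpha> r"
proof -
  define P where "P r = 2 * (1 - \<alpha>) * (1 - r)^5 + \<alpha> * (1 + r) * (1 - r)^2
      - (1 + r) * (r^2 + 4 * r + 1)" for r
  have "\<exists>r\<ge>0. r \<le> 1 \<and> P r = 0"
    by (rule IVT2') (use assms in \<open>auto simp: P_def intro!: continuous_intros\<close>)
  then obtain r where r: "0 \<le> r" "r \<le> 1" "P r = 0" by blast
  have "r \<noteq> 0" "r \<noteq> 1" using r(3) assms by (auto simp: P_def)
  then have "is_s0_root \<alpha> r" using r by (simp add: is_s0_root_def P_def)
  moreover have "s = r" if "is_s0_root \<alpha> s" for s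
    using that \<open>is_s0_root \<alpha> r\<close> majorant_strict_mono[OF \<open>\<alpha> < 1\<close>]
    unfolding is_s0_root_iff_majorant by (metis less_irrefl less_le linorder_neqE_linordered_idom)
  ultimately show ?thesis by blast
qed

lemma is_s0_root_s0:
  assumes "0 \<le> \<alpha>" "\<alpha> < 1"
  shows "is_s0_root \<alpha> (s0 \<alpha>)"
  unfolding s0_def using theI'[OF ex1_is_s0_root[OF assms]] .

lemma majorant_less_iff:
  assumes "0 \<le> \<alpha>" "\<alpha> < 1" "0 \<le> r" "r < 1"
  shows "majorant \<alpha> r < 2 * (1 - \<alpha>) \<longleftrightarrow> r < s0 \<alpha>"
proof -
  have s: "0 < s0 \<alpha>" "s0 \<alpha> < 1" "majorant \<alpha> (s0 \<alpha>) = 2 * (1 - \<alpha>)"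
    using is_s0_root_s0[OF assms(1,2)] by (auto simp: is_s0_root_iff_majorant)
  show ?thesis
    using majorant_strict_mono[OF assms(2), of r "s0 \<alpha>"]
      majorant_strict_mono[OF assms(2), of "s0 \<alpha>" r] s assms
    by (cases r "s0 \<alpha>" rule: linorder_cases) auto
qed

text \<open>The endpoints of the interval are the given value plus and minus the tolerance; the sign of
\<open>majorant 0 r - 2\<close> at each endpoint tells on which side of \<open>s0 0\<close> it lies.\<close>

lemma s0_0_approx: "\<bar>s0 0 - 0.0712543\<bar> < 5 / 10^8"
proof -
  have "0.07125425 < s0 0"
    by (subst majorant_less_iff[symmetric]) (simp_all add: majorant_def divide_simps)
  moreover have "\<not> 0.07125435 < s0 0" "s0 0 \<noteq> 0.07125435"
  proof -
    show "\<not> 0.07125435 < s0 0"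
      by (subst majorant_less_iff[symmetric]) (simp_all add: majorant_def divide_simps)
    show "s0 0 \<noteq> 0.07125435"
    proof
      assume eq: "s0 0 = 0.07125435"
      have "is_s0_root 0 (s0 0)" by (rule is_s0_root_s0) simp_all
      then have "is_s0_root 0 0.07125435" unfolding eq .
      then show False by (simp add: is_s0_root_def power_divide)
    qed
  qed
  ultimately show ?thesis by (simp add: abs_if)
qed

text \<open>The coefficients are \<open>n (n - \<alpha>) ((n + 1) / 2)\<^sup>2 + n (n + \<alpha>) ((n - 1) / 2)\<^sup>2\<close>, the extremal case of the
coefficient inequality.\<close>

lemma majorant_sums:
  assumes "0 \<le> r" "r < 1"
  shows "(\<lambda>n. (real n)\<^sup>2 * ((real n)\<^sup>2 + 1 - 2 * \<alpha>) / 2 * r ^ n) sums (r * majorant \<alpha> r)"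
proof -
  define one :: "nat \<Rightarrow> real" where "one = (\<lambda>_. 1)"
  have geo: "unit_summable one"
    "powser (euler (euler one)) r = r * (1 + r) / (1 - r)^3"
    "powser (euler (euler (euler (euler one)))) r
       = r * (1 + r) * (1 + 10 * r + r\<^sup>2) / (1 - r)^5"
    unfolding one_def using geometric_euler_closed_forms[of r] assms by auto
  have sums: "(\<lambda>n. c n * r ^ n) sums powser c r" if "unit_summable c" for c
    using that assms by (simp add: unit_summable_def powser_def summable_sums)
  note us = geo(1)[THEN unit_summable_euler, THEN unit_summable_euler]
  have "(\<lambda>n. (1 / 2) * (euler (euler (euler (euler one))) n * r ^ n
        + (1 - 2 * \<alpha>) * (euler (euler one) n * r ^ n)))
     sums ((1 / 2) * (powser (euler (euler (euler (euler one)))) r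
        + (1 - 2 * \<alpha>) * powser (euler (euler one)) r))"
    by (intro sums_add sums_mult sums us[THEN unit_summable_euler, THEN unit_summable_euler] us)
  also have "(\<lambda>n. (1 / 2) * (euler (euler (euler (euler one))) n * r ^ n
        + (1 - 2 * \<alpha>) * (euler (euler one) n * r ^ n)))
     = (\<lambda>n. (real n)\<^sup>2 * ((real n)\<^sup>2 + 1 - 2 * \<alpha>) / 2 * r ^ n)"
    by (auto simp: euler_def one_def power2_eq_square algebra_simps)
  also have "powser (euler (euler (euler (euler one)))) r
        + (1 - 2 * \<alpha>) * powser (euler (euler one)) r = 2 * (r * majorant \<alpha> r)"
  proof -
    have frac: "r * (1 + r) / (1 - r)^3 = r * (1 + r) * (1 - r)^2 / (1 - r)^5"
      "(1 - \<alpha>) * (1 + r) / (1 - r)^3 = (1 - \<alpha>) * (1 + r) * (1 - r)^2 / (1 - r)^5"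
      using assms by (simp_all add: power_numeral_reduce)
    show ?thesis
      unfolding geo majorant_def unfolding frac unfolding divide_inverse
      by (simp add: power2_eq_square algebra_simps)
  qed
  finally show ?thesis by simp
qed

text \<open>The term \<open>n = 1\<close> of the majorant series equals \<open>(1 - \<alpha>) r\<close> and is absent from the coefficient sum,
which is therefore at most \<open>r majorant \<alpha> r - (1 - \<alpha>) r\<close>; below \<open>s0 \<alpha>\<close> this is less than
\<open>(1 - \<alpha>) r\<close>.\<close>

lemma coefficient_sum_less:
  fixes a b :: "nat \<Rightarrow> complex"
  assumes \<alpha>: "0 \<le> \<alpha>" "\<alpha> < 1" and r: "0 < r" "r < s0 \<alpha>"
    and a: "unit_summable a" and b: "unit_summable b"
    and a1: "a 1 = 0" and b1: "b 1 = 0"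
    and na: "\<And>n. norm (a n) \<le> ((real n + 1) / 2)\<^sup>2"
    and nb: "\<And>n. norm (b n) \<le> ((real n - 1) / 2)\<^sup>2"
  shows "coefficient_sum \<alpha> a b r < (1 - \<alpha>) * r"
proof -
  have r1: "r < 1" using r is_s0_root_s0[OF \<alpha>] by (simp add: is_s0_root_def)
  let ?c = "\<lambda>n. real n * (real n - \<alpha>) * norm (a n) + real n * (real n + \<alpha>) * norm (b n)"
  let ?m = "\<lambda>n. (real n)\<^sup>2 * ((real n)\<^sup>2 + 1 - 2 * \<alpha>) / 2"
  have "(\<lambda>n. if n = 1 then (1 - \<alpha>) * r else 0) sums ((1 - \<alpha>) * r)"
    by (rule sums_single)
  with majorant_sums[of r \<alpha>] r r1
  have m: "(\<lambda>n. ?m n * r ^ n - (if n = 1 then (1 - \<alpha>) * r else 0)) sums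
      (r * majorant \<alpha> r - (1 - \<alpha>) * r)"
    by (intro sums_diff) auto
  have le: "?c n * r ^ n \<le> ?m n * r ^ n - (if n = 1 then (1 - \<alpha>) * r else 0)" for n
  proof -
    consider "n = 0" | "n = 1" | "n \<ge> 2" by linarith
    then show ?thesis
    proof cases
      case 3
      have "?c n \<le> real n * (real n - \<alpha>) * ((real n + 1) / 2)\<^sup>2
          + real n * (real n + \<alpha>) * ((real n - 1) / 2)\<^sup>2"
        using \<alpha> 3 na nb by (intro add_mono mult_left_mono) auto
      also have "\<dots> = ?m n"
        by (simp add: power2_eq_square field_simps)
      finally show ?thesis using 3 r by (simp add: mult_right_mono)
    qed (use a1 b1 in \<open>simp_all add: field_simps\<close>)
  qed
  have sc: "summable (\<lambda>n. ?c n * r ^ n)"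
  proof -
    have "unit_summable (\<lambda>n. real n * (real n + \<beta>) * norm (c n))"
      if "unit_summable c" for \<beta> and c :: "nat \<Rightarrow> complex"
      using powser_euler_combination(1)[OF unit_summable_norm[OF that], of 0] by simp
    from this[OF a, of "- \<alpha>"] this[OF b, of \<alpha>] show ?thesis
      unfolding unit_summable_def distrib_right using r r1 by (auto intro!: summable_add)
  qed
  have "coefficient_sum \<alpha> a b r \<le> r * majorant \<alpha> r - (1 - \<alpha>) * r"
    unfolding coefficient_sum_def powser_def
    using suminf_le[OF le sc sums_summable[OF m]] unfolding sums_unique[OF m, symmetric] .
  also have "\<dots> < r * (2 * (1 - \<alpha>)) - (1 - \<alpha>) * r"
    using majorant_less_iff[OF \<alpha>, of r] r r1 by simp
  finally show ?thesis by (simp add: algebra_simps)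
qed

section \<open>The radius of full convexity\<close>

theorem theorem4p4:
  fixes \<alpha> :: real and a b :: "nat \<Rightarrow> complex" and f h g :: "complex \<Rightarrow> complex"
  assumes "0 \<le> \<alpha>" and "\<alpha> < 1"
    and "a 1 = 1"
    and "\<And>n. n \<ge> 1 \<Longrightarrow> norm (a n) \<le> ((real n + 1) / 2)^2"
    and "\<And>n. n \<ge> 1 \<Longrightarrow> norm (b n) \<le> ((real n - 1) / 2)^2"
    and "\<And>z. norm z < 1 \<Longrightarrow> h z = z + (\<Sum>n. a (n + 2) * z ^ (n + 2))"
    and "\<And>z. norm z < 1 \<Longrightarrow> g z = (\<Sum>n. b (n + 1) * z ^ (n + 1))"
    and "\<And>z. norm z < 1 \<Longrightarrow> f z = h z + cnj (g z)"
  shows "(\<exists>!r. is_s0_root \<alpha> r) \<and>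
    inj_on f (ball 0 (s0 \<alpha>)) \<and> fully_convex_order \<alpha> (s0 \<alpha>) f \<and>
    inj_on f (ball 0 (s0 0)) \<and> fully_convex (s0 0) f \<and>
    \<bar>s0 0 - 0.0712543\<bar> < 5 / 10^8"
proof -
  define A where "A n = (if n < 2 then 0 else a n)" for n
  define B where "B n = (if n < 2 then 0 else b n)" for n
  have b1: "b 1 = 0" using assms(5)[of 1] by simp
  have nA: "norm (A n) \<le> ((real n + 1) / 2)\<^sup>2" and nB: "norm (B n) \<le> ((real n - 1) / 2)\<^sup>2" for n
    using assms(4,5)[of n] by (auto simp: A_def B_def)
  \<comment> \<open>Both bounds are at most \<open>n\<^sup>2\<close>, which suffices for convergence in the unit disk.\<close>
  have us2: "unit_summable (\<lambda>n. (real n)\<^sup>2)"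
    using unit_summable_euler[OF unit_summable_euler[OF geometric_euler_closed_forms(1)[of 0]]]
    by (simp add: euler_def[abs_def] power2_eq_square)
  have usA: "unit_summable A"
  proof (rule unit_summable_comparison[OF us2])
    fix n
    show "norm (A n) \<le> (real n)\<^sup>2"
    proof (cases "n < 2")
      case False
      then have "((real n + 1) / 2)\<^sup>2 \<le> (real n)\<^sup>2"
        by (intro power_mono) auto
      then show ?thesis using nA[of n] by linarith
    qed (simp add: A_def)
  qed
  have usB: "unit_summable B"
  proof (rule unit_summable_comparison[OF us2])
    fix n
    show "norm (B n) \<le> (real n)\<^sup>2"
    proof (cases "n < 2")
      case False
      then have "((real n - 1) / 2)\<^sup>2 \<le> (real n)\<^sup>2"
        by (intro power_mono) auto
      then show ?thesis using nB[of n] by linarith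
    qed (simp add: B_def)
  qed
  have f: "f z = z + powser A z + cnj (powser B z)" if "norm z < 1" for z
  proof -
    have "powser A z = (\<Sum>n. A (n + 2) * z ^ (n + 2)) + (\<Sum>n<2. A n * z ^ n)"
      unfolding powser_def using usA that
      by (intro suminf_split_initial_segment) (simp add: unit_summable_def)
    moreover have "(\<Sum>n<2. A n * z ^ n) = 0" by (simp add: A_def)
    ultimately have "h z = z + powser A z"
      using assms(6)[OF that] by (simp add: A_def)
    moreover have "powser B z = (\<Sum>n. B (n + 1) * z ^ (n + 1)) + (\<Sum>n<1. B n * z ^ n)"
      unfolding powser_def using usB that
      by (intro suminf_split_initial_segment) (simp add: unit_summable_def)
    moreover have "B (n + 1) = b (n + 1)" for n using b1 by (cases n) (auto simp: B_def)
    moreover have "B 0 = 0" by (simp add: B_def)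
    ultimately show ?thesis
      using assms(7,8)[OF that] by simp
  qed
  have main: "inj_on f (ball 0 (s0 \<beta>))" "fully_convex_order \<beta> (s0 \<beta>) f"
    if \<beta>: "0 \<le> \<beta>" "\<beta> < 1" for \<beta>
  proof -
    have "s0 \<beta> \<le> 1"
      using is_s0_root_s0[OF \<beta>] by (simp add: is_s0_root_def)
    moreover have "coefficient_sum \<beta> A B r < (1 - \<beta>) * r" if "0 < r" "r < s0 \<beta>" for r
      by (rule coefficient_sum_less[OF \<beta> that usA usB _ _ nA nB]) (simp_all add: A_def B_def)
    ultimately show "inj_on f (ball 0 (s0 \<beta>))" "fully_convex_order \<beta> (s0 \<beta>) f"
      using fully_convex_order_of_coefficient_sum[OF \<beta> usA usB, of "s0 \<beta>" f] f
      by auto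
  qed
  show ?thesis
    using ex1_is_s0_root[OF assms(1,2)] main[OF assms(1,2)] main[of 0] s0_0_approx
    unfolding fully_convex_def by simp
qed

end
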